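(* Consider a least core selecting payment rule $p^{\mathrm{LC}}$ for the market described in the context: $p_a^{\mathrm{LC}}(\mathcal{B})=b_a(\chi^*_{E_a}(\mathcal{B}))-\bar u_a(\mathcal{B})$ for all $a\in A$, where for every admissible bid profile $\mathcal{B}$ the vector $\{\bar u_a(\mathcal{B})\}_{a\in A}$ lies in the least core $K_{\mathrm{Core}}(\mathcal{B},\epsilon^*(\mathcal{B}))$. Then: (i) Let $\bar\epsilon\in\mathbb{R}$ satisfy $\epsilon^*(\mathcal{B})\le\bar\epsilon$ for all admissible bid profiles $\mathcal{B}$. Suppose a coalition $S\subset A$ (proper subset) strategizes as a group to pick its bids $\mathcal{B}_S$. Then, for every admissible profile $\mathcal{B}=\mathcal{B}_S\cup\mathcal{B}_{-S}$, the total true utility of $S$ under $p^{\mathrm{LC}}$ exceeds by at most $\bar\epsilon$ the utility that $S$ obtains when it participates (truthfully) as a single merged area in a VCG mechanism against $\mathcal{B}_{-S}$: $$\sum_{a\in S}u_a(\mathcal{B})\;\le\; u_S^{\mathrm{VCG}}(\mathcal{V}_S\,|\,\mathcal{B}_{-S})+\bar\epsilon .$$ (ii) The least core selecting payment rule yields an individually rational mechanism: for every admissible bid profile $\mathcal{B}$ and every $a\in A$, $\bar u_a(\mathcal{B})=b_a(\chi^*_{E_a}(\mathcal{B}))-p_a^{\mathrm{LC}}(\mathcal{B})\ge 0$.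
   Context: Market. $(A,E)$ is a finite connected simple undirected graph; $A$ is the set of areas, $E$ the set of links. For $S\subseteq A$, $E_S$ is the set of links with exactly one endpoint in $S$ (write $E_a=E_{\{a\}}$), and $E^S$ is the set of links with both endpoints in $S$. An allocation is $\chi\in[0,1]^E$; for $F\subseteq E$, $\chi_F=\{\chi_e\}_{e\in F}$. A default allocation $\chi'\in[0,1]^E$ and a set $\mathbb{S}\subseteq[0,1]^E$ with $\chi'\in\mathbb{S}$ are fixed. Each area $a$ has a true valuation $v_a:\mathbb{X}_a\to\mathbb{R}$, where $\chi'_{E_a}\in\mathbb{X}_a\subseteq[0,1]^{E_a}$ and $v_a(\chi'_{E_a})=0$; by convention $v_a=-\infty$ outside $\mathbb{X}_a$. Each area submits a (possibly nontruthful) bid $b_a:\hat{\mathbb{X}}_a\to\mathbb{R}$ with $\chi'_{E_a}\in\hat{\mathbb{X}}_a\subseteq[0,1]^{E_a}$ and $b_a(\chi'_{E_a})=0$. No continuity, convexity, monotonicity or sign conditions are imposed. A bid profile is $\mathcal{B}=\{b_a\}_{a\in A}$, the true profile is $\mathcal{V}=\{v_a\}_{a\in A}$; for $S\subseteq A$, $\mathcal{B}_S=\{b_a\}_{a\in S}$, $\mathcal{B}_{-S}=\{b_a\}_{a\in A\setminus S}$, and similarly $\mathcal{V}_S$. Each area has a set of admissible bids containing $v_a$, a profile is admissible if every component is, and all maxima below are assumed attained for admissible profiles. Allocation rule: $\chi^*(\mathcal{B})$ is a maximizer (selected by a fixed tie-breaking rule) of $$V(\mathcal{B})=\max_{\chi\in\mathbb{S}}\sum_{a\in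 A}b_a(\chi_{E_a})\ \text{ s.t. } \chi_{E_a}\in\hat{\mathbb{X}}_a\ \forall a\in A.$$ For $S\subseteq A$, $$V(\mathcal{B}_S)=\max_{\chi\in\mathbb{S}}\sum_{a\in S}b_a(\chi_{E_a})\ \text{ s.t. } \chi_{E_a}\in\hat{\mathbb{X}}_a\ \forall a\in S,\quad \chi_e=\chi'_e\ \forall e\in E\setminus E^S.$$ A payment rule assigns $p_a(\mathcal{B})\in\mathbb{R}$ to each area. True utilities: $u_a(\mathcal{B})=v_a(\chi^*_{E_a}(\mathcal{B}))-p_a(\mathcal{B})$. Revealed utilities: $\bar u_a(\mathcal{B})=b_a(\chi^*_{E_a}(\mathcal{B}))-p_a(\mathcal{B})$. Least core. For $\epsilon\ge0$, $K_{\mathrm{Core}}(\mathcal{B},\epsilon)=\{\bar u\in\mathbb{R}^A : \sum_{a\in A}\bar u_a=V(\mathcal{B}),\ \sum_{a\in S}\bar u_a\ge V(\mathcal{B}_S)-\epsilon\ \ \forall S\subset A\}$, where $S\subset A$ means proper subset; $\epsilon^*(\mathcal{B})=\min\{\epsilon\ge0 : K_{\mathrm{Core}}(\mathcal{B},\epsilon)\ne\emptyset\}$; the least core is $K_{\mathrm{Core}}(\mathcal{B},\epsilon^*(\mathcal{B}))$. Merged participation in VCG. When $S$ participates as a single area with its true valuations, its merged valuation of the links in $E_S$ is obtained by maximizing $\sum_{a\in S}v_a(\chi_{E_a})$ over the internal links $\chi_{E^S}$ (subject to $\chi_{E_a}\in\mathbb{X}_a$ for $a\in S$), the market constraint $\chi\in\mathbb{S}$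 being kept. The optimal value of the resulting market is $V(\mathcal{V}_S\cup\mathcal{B}_{-S})$, i.e. the maximum over $\chi\in\mathbb{S}$ of $\sum_{a\in S}v_a(\chi_{E_a})+\sum_{a\in A\setminus S}b_a(\chi_{E_a})$ subject to $\chi_{E_a}\in\mathbb{X}_a$ for $a\in S$ and $\chi_{E_a}\in\hat{\mathbb{X}}_a$ for $a\in A\setminus S$. The (total) VCG utility of the merged area is $u_S^{\mathrm{VCG}}(\mathcal{V}_S\,|\,\mathcal{B}_{-S})=V(\mathcal{V}_S\cup\mathcal{B}_{-S})-V(\mathcal{B}_{-S})$. *)

theory Defs
  imports Complex_Main "HOL-Library.FuncSet" "HOL-Library.Extended_Real"
begin

definition connected_simple_graph :: "'a set \<Rightarrow> 'a set set \<Rightarrow> bool" where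
  "connected_simple_graph A E \<longleftrightarrow>
     finite A \<and> A \<noteq> {} \<and>
     E \<subseteq> {e. e \<subseteq> A \<and> card e = 2} \<and>
     (\<forall>x\<in>A. \<forall>y\<in>A. (x, y) \<in> {(s, t). {s, t} \<in> E}\<^sup>*)"

text \<open>
  Elements of \<open>[0,1]\<^sup>F\<close>, for a set \<open>F\<close> of links, are extensional functions on \<open>F\<close>.
  A bid is a partial function whose domain is the set of link values it accepts, so
  \<^const>\<open>None\<close> encodes the value \<open>-\<infinity>\<close>.
\<close>

type_synonym 'a allocation = "'a set \<Rightarrow> real"
type_synonym 'a bid = "'a allocation \<rightharpoonup> real"
type_synonym 'a profile = "'a \<Rightarrow> 'a bid"

definition unit_cube :: "'a set set \<Rightarrow> 'a allocation set" where
  "unit_cube F = PiE F (\<lambda>_. {0..1})"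

record 'a market =
  areas :: "'a set"
  links :: "'a set set"
  default_allocation :: "'a allocation"
  allocations :: "'a allocation set"
  valuation :: "'a profile"
  admissible_bids :: "'a \<Rightarrow> 'a bid set"

definition boundary_links :: "'a market \<Rightarrow> 'a set \<Rightarrow> 'a set set" where
  "boundary_links M S = {e \<in> links M. card (e \<inter> S) = 1}"

definition internal_links :: "'a market \<Rightarrow> 'a set \<Rightarrow> 'a set set" where
  "internal_links M S = {e \<in> links M. e \<subseteq> S}"

definition local_part :: "'a market \<Rightarrow> 'a allocation \<Rightarrow> 'a \<Rightarrow> 'a allocation" where
  "local_part M x a = restrict x (boundary_links M {a})"

definition is_bid :: "'a market \<Rightarrow> 'a \<Rightarrow> 'a bid \<Rightarrow> bool" where
  "is_bid M a b \<longleftrightarrow>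
     dom b \<subseteq> unit_cube (boundary_links M {a}) \<and>
     b (local_part M (default_allocation M) a) = Some 0"

text \<open>Profiles are extensional, so they carry no data outside the set of areas.\<close>

definition admissible_profiles :: "'a market \<Rightarrow> 'a profile set" where
  "admissible_profiles M = PiE (areas M) (admissible_bids M)"

definition feasible :: "'a market \<Rightarrow> 'a profile \<Rightarrow> 'a set \<Rightarrow> 'a allocation \<Rightarrow> bool" where
  "feasible M B S x \<longleftrightarrow>
     x \<in> allocations M \<and>
     (\<forall>a\<in>S. local_part M x a \<in> dom (B a)) \<and>
     (\<forall>e \<in> links M - internal_links M S. x e = default_allocation M e)"

definition total_value :: "'a market \<Rightarrow> 'a profile \<Rightarrow> 'a set \<Rightarrow> 'a allocation \<Rightarrow> real" where
  "total_value M B S x = (\<Sum>a\<in>S. the (B a (local_part M x a)))"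

text \<open>
  The optimal value for the bids of the coalition \<open>S\<close>. For \<open>S = areas M\<close> every link is
  internal, so no link is forced to its default and this is the value of the whole market.
  The supremum is a maximum by the attainment condition in \<open>valid_market\<close> below.
\<close>

definition opt_value :: "'a market \<Rightarrow> 'a profile \<Rightarrow> 'a set \<Rightarrow> real" where
  "opt_value M B S = (SUP x \<in> {x. feasible M B S x}. total_value M B S x)"

definition valid_market :: "'a market \<Rightarrow> bool" where
  "valid_market M \<longleftrightarrow>
     connected_simple_graph (areas M) (links M) \<and>
     allocations M \<subseteq> unit_cube (links M) \<and>
     default_allocation M \<in> allocations M \<and>
     (\<forall>a\<in>areas M. valuation M a \<in> admissible_bids M a) \<and>
     (\<forall>a\<in>areas M. \<forall>b\<in>admissible_bids M a. is_bid M a b) \<and>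
     (\<forall>B\<in>admissible_profiles M. \<forall>S\<subseteq>areas M.
        \<exists>x. is_arg_max (total_value M B S) (feasible M B S) x)"

text \<open>An allocation rule is a function of the bid profile, which fixes the tie-breaking.\<close>

definition allocation_rule :: "'a market \<Rightarrow> ('a profile \<Rightarrow> 'a allocation) \<Rightarrow> bool" where
  "allocation_rule M alloc \<longleftrightarrow>
     (\<forall>B\<in>admissible_profiles M.
        is_arg_max (total_value M B (areas M)) (feasible M B (areas M)) (alloc B))"

definition extended_value :: "'a bid \<Rightarrow> 'a allocation \<Rightarrow> ereal" where
  "extended_value b y = (case b y of Some r \<Rightarrow> ereal r | None \<Rightarrow> -\<infinity>)"

text \<open>
  The selected allocation may lie outside the domain of the true valuation of an area, so
  true utilities can be \<open>-\<infinity>\<close>; it never lies outside the domain of a submitted bid.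
\<close>

definition true_utility ::
  "'a market \<Rightarrow> ('a profile \<Rightarrow> 'a allocation) \<Rightarrow> ('a profile \<Rightarrow> 'a \<Rightarrow> real) \<Rightarrow> 'a profile \<Rightarrow> 'a \<Rightarrow> ereal"
  where
  "true_utility M alloc p B a =
     extended_value (valuation M a) (local_part M (alloc B) a) - ereal (p B a)"

definition revealed_utility ::
  "'a market \<Rightarrow> ('a profile \<Rightarrow> 'a allocation) \<Rightarrow> ('a profile \<Rightarrow> 'a \<Rightarrow> real) \<Rightarrow> 'a profile \<Rightarrow> 'a \<Rightarrow> real"
  where
  "revealed_utility M alloc p B a = the (B a (local_part M (alloc B) a)) - p B a"

definition relaxed_core :: "'a market \<Rightarrow> 'a profile \<Rightarrow> real \<Rightarrow> ('a \<Rightarrow> real) set" where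
  "relaxed_core M B \<epsilon> =
     {u \<in> PiE (areas M) (\<lambda>_. UNIV).
        (\<Sum>a\<in>areas M. u a) = opt_value M B (areas M) \<and>
        (\<forall>S. S \<subset> areas M \<longrightarrow> (\<Sum>a\<in>S. u a) \<ge> opt_value M B S - \<epsilon>)}"

text \<open>
  The infimum is a minimum: the relaxed cores are compact, increase with \<open>\<epsilon>\<close>, and are
  nonempty for large \<open>\<epsilon>\<close>.
\<close>

definition min_relaxation :: "'a market \<Rightarrow> 'a profile \<Rightarrow> real" where
  "min_relaxation M B = Inf {\<epsilon>. 0 \<le> \<epsilon> \<and> relaxed_core M B \<epsilon> \<noteq> {}}"

definition least_core :: "'a market \<Rightarrow> 'a profile \<Rightarrow> ('a \<Rightarrow> real) set" where
  "least_core M B = relaxed_core M B (min_relaxation M B)"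

definition least_core_selecting ::
  "'a market \<Rightarrow> ('a profile \<Rightarrow> 'a allocation) \<Rightarrow> ('a profile \<Rightarrow> 'a \<Rightarrow> real) \<Rightarrow> bool" where
  "least_core_selecting M alloc p \<longleftrightarrow>
     (\<forall>B\<in>admissible_profiles M. \<exists>u\<in>least_core M B. \<forall>a\<in>areas M.
        p B a = the (B a (local_part M (alloc B) a)) - u a)"

text \<open>
  The VCG utility of \<open>S\<close> bidding truthfully as one merged area against the bids of the other
  areas in \<open>B\<close>; the components of \<open>B\<close> in \<open>S\<close> are not used.
\<close>

definition merged_vcg_utility :: "'a market \<Rightarrow> 'a profile \<Rightarrow> 'a set \<Rightarrow> real" where
  "merged_vcg_utility M B S =
     opt_value M (override_on B (valuation M) S) (areas M) - opt_value M B (areas M - S)"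

end

theory Submission
  imports Defs
begin

text \<open>
  (i) The core inequality for \<open>A - S\<close> together with efficiency bounds the revealed utility
  of \<open>S\<close> by \<open>V(\<B>) - V(\<B>\<^sub>-\<^sub>S) + \<epsilon>\<close>. Replacing the bids of \<open>S\<close> by its valuations at the selected
  allocation turns \<open>V(\<B>)\<close> into the value of an allocation that is feasible for the merged market.

  (ii) If \<open>u a < 0\<close> for some \<open>u\<close> in the least core, then every coalition without \<open>a\<close> has slack
  at least \<open>- u a\<close>, because adding \<open>a\<close> to a coalition does not decrease its value. A small
  transfer to \<open>a\<close> from all other areas makes every core inequality slack, contradicting the
  minimality of the relaxation.
\<close>

section \<open>Optimal values of coalitions\<close>

lemma local_part_eq_default:
  assumes "feasible M B S x" and "a \<notin> S"
  shows "local_part M x a = local_part M (default_allocation M) a"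
proof -
  \<comment> \<open>A link at \<open>a\<close> is not contained in \<open>S\<close>, so feasibility
    for \<open>S\<close> pins it to its default.\<close>
  have "x e = default_allocation M e" if "e \<in> boundary_links M {a}" for e
  proof -
    from that have "e \<in> links M" "card (e \<inter> {a}) = 1"
      by (auto simp: boundary_links_def)
    moreover from this have "a \<in> e"
      by (cases "a \<in> e") auto
    ultimately show ?thesis
      using assms by (auto simp: feasible_def internal_links_def)
  qed
  then show ?thesis
    by (auto simp: local_part_def restrict_def)
qed

lemma opt_value_arg_max:
  assumes "is_arg_max (total_value M B S) (feasible M B S) x"
  shows "opt_value M B S = total_value M B S x"
proof -
  have "feasible M B S x" and "\<And>y. feasible M B S y \<Longrightarrow> total_value M B S y \<le> total_value M B S x"
    using assms by (simp_all add: is_arg_max_linorder)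
  then show ?thesis
    unfolding opt_value_def by (intro cSup_eq_maximum) blast+
qed

lemma valid_market_arg_max:
  assumes "valid_market M" and "B \<in> admissible_profiles M" and "S \<subseteq> areas M"
  obtains x where "is_arg_max (total_value M B S) (feasible M B S) x"
  using assms unfolding valid_market_def by blast

lemma total_value_le_opt_value:
  assumes "valid_market M" and "B \<in> admissible_profiles M" and "S \<subseteq> areas M"
    and "feasible M B S x"
  shows "total_value M B S x \<le> opt_value M B S"
proof -
  obtain y where y: "is_arg_max (total_value M B S) (feasible M B S) y"
    using valid_market_arg_max[OF assms(1-3)] .
  then show ?thesis
    using assms(4) unfolding opt_value_arg_max[OF y] is_arg_max_linorder by blast
qed

lemma finite_areas: "valid_market M \<Longrightarrow> finite (areas M)"
  by (simp add: valid_market_def connected_simple_graph_def)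

lemma bid_at_default:
  assumes "valid_market M" and "B \<in> admissible_profiles M" and "a \<in> areas M"
  shows "B a (local_part M (default_allocation M) a) = Some 0"
proof -
  have "B a \<in> admissible_bids M a"
    using assms(2,3) by (auto simp: admissible_profiles_def)
  then show ?thesis
    using assms(1,3) unfolding valid_market_def is_bid_def by blast
qed

text \<open>Every feasible allocation contributes an empty sum; attainment guarantees that there is
  one, so the supremum ranges over {0} and not over the empty set.\<close>

lemma opt_value_empty:
  assumes "valid_market M" and "B \<in> admissible_profiles M"
  shows "opt_value M B {} = 0"
proof -
  obtain x where "is_arg_max (total_value M B {}) (feasible M B {}) x"
    using valid_market_arg_max[OF assms] by blast
  then show ?thesis
    by (simp add: opt_value_arg_max total_value_def)
qed

text \<open>An optimal allocation for \<open>S\<close> keeps the links of \<open>a\<close> at their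
  defaults, where the bid of \<open>a\<close> is 0. It therefore competes for
  \<open>insert a S\<close> with the same value.\<close>

lemma opt_value_insert_mono:
  assumes M: "valid_market M" and B: "B \<in> admissible_profiles M"
    and S: "insert a S \<subseteq> areas M" and a: "a \<notin> S"
  shows "opt_value M B S \<le> opt_value M B (insert a S)"
proof -
  obtain x where x: "is_arg_max (total_value M B S) (feasible M B S) x"
    using valid_market_arg_max[OF M B] S by blast
  then have feas: "feasible M B S x"
    by (simp add: is_arg_max_def)
  have bid: "B a (local_part M x a) = Some 0"
    using local_part_eq_default[OF feas a] bid_at_default[OF M B] S by simp
  have "feasible M B (insert a S) x"
    using feas bid by (auto simp: feasible_def internal_links_def)
  moreover have "total_value M B (insert a S) x = total_value M B S x"
    using bid a S finite_areas[OF M] finite_subset[of S "areas M"]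
    by (simp add: total_value_def)
  ultimately show ?thesis
    using total_value_le_opt_value[OF M B S, of x] opt_value_arg_max[OF x] by simp
qed

section \<open>Relaxed cores and the minimal relaxation\<close>

lemma relaxed_core_mono:
  assumes "\<epsilon> \<le> \<delta>"
  shows "relaxed_core M B \<epsilon> \<subseteq> relaxed_core M B \<delta>"
proof
  fix u
  assume u: "u \<in> relaxed_core M B \<epsilon>"
  have "opt_value M B S - \<delta> \<le> sum u S" if "S \<subset> areas M" for S
  proof -
    have "opt_value M B S - \<epsilon> \<le> sum u S"
      using u that unfolding relaxed_core_def by blast
    with assms show ?thesis by simp
  qed
  then show "u \<in> relaxed_core M B \<delta>"
    using u unfolding relaxed_core_def by blast
qed

lemma min_relaxation_le:
  assumes "0 \<le> \<epsilon>" and "u \<in> relaxed_core M B \<epsilon>"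
  shows "min_relaxation M B \<le> \<epsilon>"
  unfolding min_relaxation_def
  using assms by (intro cInf_lower) auto

text \<open>
  Without the assumption the infimum could range over the empty set, where its value is
  unspecified.
\<close>

lemma min_relaxation_nonneg:
  assumes "u \<in> least_core M B"
  shows "0 \<le> min_relaxation M B"
proof (rule ccontr)
  assume neg: "\<not> 0 \<le> min_relaxation M B"
  \<comment> \<open>Here \<open>u\<close> witnesses that 0 belongs to the set under the infimum,
    which is thus nonempty and bounded below by 0.\<close>
  then have "u \<in> relaxed_core M B 0"
    using assms relaxed_core_mono[of "min_relaxation M B" 0 M B]
    by (auto simp: least_core_def)
  then have "0 \<le> min_relaxation M B"
    unfolding min_relaxation_def by (intro cInf_greatest) auto
  with neg show False ..
qed

section \<open>Nonnegativity of least core payoffs\<close>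

lemma least_core_nonneg:
  assumes M: "valid_market M" and B: "B \<in> admissible_profiles M"
    and u: "u \<in> least_core M B" and a: "a \<in> areas M"
  shows "0 \<le> u a"
proof (rule ccontr)
  assume "\<not> 0 \<le> u a"
  then have neg: "u a < 0" by simp
  define A where "A = areas M"
  define \<epsilon> where "\<epsilon> = min_relaxation M B"
  \<comment> \<open>Each area gives up \<open>d\<close> and \<open>a\<close> receives the pool
    \<open>card A * d\<close>, so the total is preserved. The pool equals \<open>- u a\<close>, the
    slack guaranteed to coalitions without \<open>a\<close>.\<close>
  define d where "d = - u a / real (card A)"
  define w where "w = restrict (\<lambda>b. u b - d + (if b = a then real (card A) * d else 0)) A"
  have fin: "finite A" and aA: "a \<in> A"
    using finite_areas[OF M] a by (simp_all add: A_def)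
  then have card_pos: "0 < card A"
    by (auto simp: card_gt_0_iff)
  then have d_pos: "0 < d" and card_d: "real (card A) * d = - u a"
    using neg by (simp_all add: d_def divide_neg_pos)
  have total: "sum u A = opt_value M B A"
    and core: "\<And>S. S \<subset> A \<Longrightarrow> opt_value M B S - \<epsilon> \<le> sum u S"
    using u by (auto simp: least_core_def relaxed_core_def A_def \<epsilon>_def)
  \<comment> \<open>The goal of the next steps is \<open>0 \<le> \<epsilon> - d\<close>, since the
    infimum ranges over nonnegative relaxations only. The core inequality for \<open>{a}\<close>
    bounds \<open>- u a\<close> by \<open>\<epsilon>\<close>; it applies because
    \<open>A = {a}\<close> would make \<open>u a\<close> the nonnegative total value.\<close>
  have "0 \<le> opt_value M B {a}"
    using opt_value_insert_mono[OF M B, of a "{}"] a opt_value_empty[OF M B] by simp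
  moreover from this have "{a} \<noteq> A"
    using total neg by auto
  then have "{a} \<subset> A"
    using aA by blast
  ultimately have "- u a \<le> \<epsilon>"
    using core[of "{a}"] by simp
  have "d \<le> - u a"
    using card_d d_pos card_pos mult_right_mono[of 1 "real (card A)" d] by simp
  then have "0 \<le> \<epsilon> - d"
    using \<open>- u a \<le> \<epsilon>\<close> by simp

  have sum_w: "sum w S = sum u S - real (card S) * d + (if a \<in> S then real (card A) * d else 0)"
    if "S \<subseteq> A" for S
  proof -
    have "sum w S = (\<Sum>b\<in>S. u b - d + (if b = a then real (card A) * d else 0))"
      using that by (intro sum.cong) (auto simp: w_def)
    then show ?thesis
      using finite_subset[OF that fin] by (simp add: sum.distrib sum_subtractf)
  qed
  have "opt_value M B S - (\<epsilon> - d) \<le> sum w S" if S: "S \<subset> A" for S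
  proof -
    \<comment> \<open>A proper coalition pays at most \<open>(card A - 1) * d\<close>, so a credit
      of \<open>card A * d\<close> leaves a surplus of \<open>d\<close>. The credit is the pool if
      \<open>a\<close> belongs to \<open>S\<close>, and the slack \<open>- u a\<close>
      otherwise.\<close>
    from S fin have "card S < card A"
      by (rule psubset_card_mono[rotated])
    then have "real (card S) + 1 \<le> real (card A)"
      by linarith
    then have "(real (card S) + 1) * d \<le> real (card A) * d"
      using d_pos by (intro mult_right_mono) auto
    then have card_S: "real (card S) * d + d \<le> real (card A) * d"
      by (simp add: algebra_simps)
    show ?thesis
    proof (cases "a \<in> S")
      case True
      then show ?thesis
        using core[OF S] sum_w[of S] S card_S by auto
    next
      case False
      have insert_le: "insert a S \<subseteq> A"
        using S aA by auto
      then have "opt_value M B S \<le> opt_value M B (insert a S)"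
        using opt_value_insert_mono[OF M B] False by (simp add: A_def)
      \<comment> \<open>If \<open>insert a S\<close> is all of \<open>A\<close>, no core inequality
        is available, but the efficiency equation and \<open>\<epsilon> > 0\<close> suffice.\<close>
      also have "\<dots> - \<epsilon> \<le> sum u (insert a S)"
        using core[of "insert a S"] insert_le total neg \<open>- u a \<le> \<epsilon>\<close>
        by (cases "insert a S = A") auto
      also have "sum u (insert a S) = u a + sum u S"
        using False S fin finite_subset[of S A] by auto
      finally show ?thesis
        using sum_w[of S] S card_S card_d False by auto
    qed
  qed
  moreover have "sum w A = opt_value M B A"
    using sum_w[of A] aA total by simp
  ultimately have "w \<in> relaxed_core M B (\<epsilon> - d)"
    by (auto simp: relaxed_core_def A_def w_def)
  from min_relaxation_le[OF \<open>0 \<le> \<epsilon> - d\<close> this] d_pos show False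
    by (simp add: \<epsilon>_def)
qed

section \<open>Comparison with the merged VCG utility\<close>

lemma least_core_coalition_le:
  assumes M: "valid_market M" and u: "u \<in> least_core M B" and S: "S \<subseteq> areas M"
  shows "sum u S \<le> opt_value M B (areas M) - opt_value M B (areas M - S) + min_relaxation M B"
\<comment> \<open>For empty \<open>S\<close> the complement is not a proper subset, and the claim
  reduces to a nonnegative relaxation.\<close>
proof (cases "S = {}")
  case True
  then show ?thesis
    using min_relaxation_nonneg[OF u] by simp
next
  case False
  then have "areas M - S \<subset> areas M"
    using S by auto
  then have "opt_value M B (areas M - S) - min_relaxation M B \<le> sum u (areas M - S)"
    and "sum u (areas M) = opt_value M B (areas M)"
    using u by (auto simp: least_core_def relaxed_core_def)
  then show ?thesis
    using sum.subset_diff[OF S finite_areas[OF M], of u] by simp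
qed

text \<open>True valuations are admissible bids, so attainment also covers the merged
  market.\<close>

lemma override_on_admissible:
  assumes "valid_market M" and "B \<in> admissible_profiles M" and "S \<subseteq> areas M"
  shows "override_on B (valuation M) S \<in> admissible_profiles M"
proof -
  have "valuation M a \<in> admissible_bids M a" if "a \<in> areas M" for a
    using assms(1) that by (simp add: valid_market_def)
  then show ?thesis
    using assms(2,3)
    by (auto simp: admissible_profiles_def override_on_def PiE_iff extensional_def)
qed

lemma opt_value_merged_ge:
  assumes M: "valid_market M" and B: "B \<in> admissible_profiles M" and S: "S \<subseteq> areas M"
    and x: "is_arg_max (total_value M B (areas M)) (feasible M B (areas M)) x"
    and dom: "\<And>a. a \<in> S \<Longrightarrow> local_part M x a \<in> dom (valuation M a)"
  shows "opt_value M B (areas M)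
      + (\<Sum>a\<in>S. the (valuation M a (local_part M x a)) - the (B a (local_part M x a)))
    \<le> opt_value M (override_on B (valuation M) S) (areas M)"
proof -
  let ?B = "override_on B (valuation M) S"
  have "feasible M B (areas M) x"
    using x by (simp add: is_arg_max_def)
  \<comment> \<open>Only the domains of areas in \<open>S\<close> change, and \<open>dom\<close>
    covers exactly those.\<close>
  then have "feasible M ?B (areas M) x"
    using dom by (auto simp: feasible_def override_on_def)
  then have le: "total_value M ?B (areas M) x \<le> opt_value M ?B (areas M)"
    by (intro total_value_le_opt_value M override_on_admissible B S order_refl)
  have "total_value M ?B (areas M) x - total_value M B (areas M) x
      = (\<Sum>a\<in>areas M. if a \<in> S
          then the (valuation M a (local_part M x a)) - the (B a (local_part M x a)) else 0)"
    unfolding total_value_def sum_subtractf[symmetric]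
    by (intro sum.cong) (auto simp: override_on_def)
  also have "\<dots> = (\<Sum>a\<in>S. the (valuation M a (local_part M x a)) - the (B a (local_part M x a)))"
    using S finite_areas[OF M] by (simp add: sum.If_cases Int_absorb1)
  finally show ?thesis
    using le opt_value_arg_max[OF x] by simp
qed

lemma sum_true_utility_le:
  assumes M: "valid_market M" and alloc: "allocation_rule M alloc"
    and p: "least_core_selecting M alloc p"
    and B: "B \<in> admissible_profiles M" and S: "S \<subseteq> areas M"
  shows "(\<Sum>a\<in>S. true_utility M alloc p B a)
    \<le> ereal (merged_vcg_utility M B S + min_relaxation M B)"
proof (cases "\<forall>a\<in>S. local_part M (alloc B) a \<in> dom (valuation M a)")
  case True
  define v where "v a = the (valuation M a (local_part M (alloc B) a))" for a
  define b where "b a = the (B a (local_part M (alloc B) a))" for a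
  obtain u where u: "u \<in> least_core M B" and pu: "\<And>a. a \<in> areas M \<Longrightarrow> p B a = b a - u a"
    using p B unfolding least_core_selecting_def b_def by blast
  have "true_utility M alloc p B a = ereal (v a - b a + u a)" if "a \<in> S" for a
  proof -
    obtain r where "valuation M a (local_part M (alloc B) a) = Some r"
      using True \<open>a \<in> S\<close> by blast
    moreover have "p B a = b a - u a"
      using that S pu by blast
    ultimately show ?thesis
      by (simp add: true_utility_def extended_value_def v_def)
  qed
  then have "(\<Sum>a\<in>S. true_utility M alloc p B a) = ereal (\<Sum>a\<in>S. v a - b a + u a)"
    by simp
  \<comment> \<open>In the sum of the two bounds the term \<open>opt_value M B (areas M)\<close>
    cancels.\<close>
  moreover have "(\<Sum>a\<in>S. v a - b a + u a) \<le> merged_vcg_utility M B S + min_relaxation M B"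
    using least_core_coalition_le[OF M u S] opt_value_merged_ge[OF M B S, of "alloc B"]
      alloc B True
    by (auto simp: merged_vcg_utility_def v_def b_def sum.distrib allocation_rule_def)
  ultimately show ?thesis
    by simp
next
  case False
  then obtain a where a: "a \<in> S" "valuation M a (local_part M (alloc B) a) = None"
    by auto
  have fin: "finite S"
    using S finite_areas[OF M] finite_subset by blast
  \<comment> \<open>In \<open>ereal\<close>, \<open>\<infinity> + (- \<infinity>)\<close> is
    \<open>\<infinity>\<close>; a summand \<open>- \<infinity>\<close> decides the sum only once
    \<open>\<infinity>\<close> is excluded from the rest.\<close>
  have "true_utility M alloc p B c \<noteq> \<infinity>" for c
    by (auto simp: true_utility_def extended_value_def split: option.splits)
  then have "(\<Sum>c\<in>S - {a}. true_utility M alloc p B c) \<noteq> \<infinity>"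
    by (simp add: sum_Pinfty)
  moreover have "true_utility M alloc p B a = - \<infinity>"
    using a by (simp add: true_utility_def extended_value_def)
  ultimately have "(\<Sum>c\<in>S. true_utility M alloc p B c) = - \<infinity>"
    using sum.remove[OF fin a(1), of "true_utility M alloc p B"] by simp
  then show ?thesis
    by simp
qed

theorem theorem1:
  fixes M :: "'a market"
    and alloc :: "'a profile \<Rightarrow> 'a allocation"
    and p :: "'a profile \<Rightarrow> 'a \<Rightarrow> real"
  assumes "valid_market M"
    and "allocation_rule M alloc"
    and "least_core_selecting M alloc p"
  shows "(\<forall>\<epsilon>::real. (\<forall>B\<in>admissible_profiles M. min_relaxation M B \<le> \<epsilon>) \<longrightarrow>
           (\<forall>S. S \<subset> areas M \<longrightarrow> (\<forall>B\<in>admissible_profiles M.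
              (\<Sum>a\<in>S. true_utility M alloc p B a) \<le> ereal (merged_vcg_utility M B S + \<epsilon>))))
       \<and> (\<forall>B\<in>admissible_profiles M. \<forall>a\<in>areas M. revealed_utility M alloc p B a \<ge> 0)"
proof (intro conjI allI impI ballI)
  fix \<epsilon> :: real and S B
  assume "\<forall>B\<in>admissible_profiles M. min_relaxation M B \<le> \<epsilon>"
    and S: "S \<subset> areas M" and B: "B \<in> admissible_profiles M"
  then have "ereal (merged_vcg_utility M B S + min_relaxation M B)
      \<le> ereal (merged_vcg_utility M B S + \<epsilon>)"
    by simp
  with sum_true_utility_le[OF assms B] S
  show "(\<Sum>a\<in>S. true_utility M alloc p B a) \<le> ereal (merged_vcg_utility M B S + \<epsilon>)"
    by (meson order_trans psubset_imp_subset)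
next
  fix B a
  assume B: "B \<in> admissible_profiles M" and a: "a \<in> areas M"
  then obtain u where "u \<in> least_core M B"
    and "p B a = the (B a (local_part M (alloc B) a)) - u a"
    using assms(3) unfolding least_core_selecting_def by blast
  then show "0 \<le> revealed_utility M alloc p B a"
    using least_core_nonneg[OF assms(1) B _ a] by (simp add: revealed_utility_def)
qed

end
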